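(* Let $G_1$ and $G_2$ be graphs such that $G_1\cap G_2$ is isomorphic to the complete graph $K_k$ on $k\ge 1$ vertices. Then $$\max\{\operatorname{th}_{\gamma_P}(G_1),\operatorname{th}_{\gamma_P}(G_2)\}\le\operatorname{th}_{\gamma_P}(G_1\cup G_2)\le\gamma_P(G_1)+\gamma_P(G_2)+k+\max\{\operatorname{ppt}(G_1),\operatorname{ppt}(G_2)\},$$ and these bounds are tight (each is attained with equality by some such $G_1,G_2$).
   Context: All graphs are finite, simple, undirected, and have at least one vertex. $G_1\cap G_2$ is the graph with vertex set $V(G_1)\cap V(G_2)$ and edge set $E(G_1)\cap E(G_2)$, and $G_1\cup G_2$ is the graph with vertex set $V(G_1)\cup V(G_2)$ and edge set $E(G_1)\cup E(G_2)$. For $S\subseteq V(G)$, $N[S]$ is the set of vertices in $S$ or adjacent to a vertex of $S$. Given $G=(V,E)$ and $S\subseteq V$, initially (timestep $0$) the vertices of $S$ are colored; in timestep $1$ every vertex in $N[S]$ becomes colored; in each subsequent timestep, every vertex which is the only non-colored neighbor of some colored vertex becomes colored. $S$ is a power dominating set if all vertices eventually become colored, and then $\operatorname{ppt}(G;S)$ is the number of timesteps needed to color all of $G$ (so $\operatorname{ppt}(G;V)=0$). The power domination number $\gamma_P(G)$ is the minimum cardinality of a power dominating set of $G$; $\operatorname{ppt}(G)=\min\{\operatorname{ppt}(G;S): S\text{ a power dominating set of }G\text{ with }|S|=\gamma_P(G)\}$; and the power domination throttling number is $\operatorname{th}_{\gamma_P}(G)=\min\{|S|+\operatorname{ppt}(G;S):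 S \text{ a power dominating set of } G\}$. *)

theory Defs
  imports "Graph_Theory.Graph_Theory"
begin

text \<open>
  As in the library, an undirected graph is a symmetric digraph. The pair representation
  \<^locale>\<open>pair_graph\<close> identifies an arc with its pair of end vertices, so arcs of different graphs
  over the same vertex type can be compared; it becomes a \<^typ>\<open>('a, 'b) pre_digraph\<close>
  through the coercion \<^const>\<open>with_proj\<close>. The library's graphs may be null, hence
  the extra conjunct.
\<close>

definition simple_graph :: "'a pair_pre_digraph \<Rightarrow> bool" where
  "simple_graph G \<longleftrightarrow> pair_graph G \<and> pverts G \<noteq> {}"

text \<open>Counterpart of \<^const>\<open>union\<close>.\<close>

definition inter :: "('a,'b) pre_digraph \<Rightarrow> ('a,'b) pre_digraph \<Rightarrow> ('a,'b) pre_digraph" where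
  "inter G H = \<lparr> verts = verts G \<inter> verts H, arcs = arcs G \<inter> arcs H, tail = tail G, head = head G \<rparr>"

definition neighbors :: "('a,'b) pre_digraph \<Rightarrow> 'a \<Rightarrow> 'a set" where
  "neighbors G v = {w. v \<rightarrow>\<^bsub>G\<^esub> w}"

definition closed_neighborhood :: "('a,'b) pre_digraph \<Rightarrow> 'a set \<Rightarrow> 'a set" where
  "closed_neighborhood G S = S \<union> (\<Union>v\<in>S. neighbors G v)"

text \<open>The set of vertices colored after a given number of timesteps, starting from \<open>S\<close>.\<close>

fun colored :: "('a,'b) pre_digraph \<Rightarrow> 'a set \<Rightarrow> nat \<Rightarrow> 'a set" where
  "colored G S 0 = S"
| "colored G S (Suc 0) = closed_neighborhood G S"
| "colored G S (Suc (Suc t)) = colored G S (Suc t) \<union>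
     {w. \<exists>v \<in> colored G S (Suc t). neighbors G v - colored G S (Suc t) = {w}}"

definition power_dominating :: "('a,'b) pre_digraph \<Rightarrow> 'a set \<Rightarrow> bool" where
  "power_dominating G S \<longleftrightarrow> S \<subseteq> verts G \<and> (\<exists>t. colored G S t = verts G)"

text \<open>Only meaningful when \<open>S\<close> is a power dominating set of \<open>G\<close>.\<close>

definition ppt_of :: "('a,'b) pre_digraph \<Rightarrow> 'a set \<Rightarrow> nat" where
  "ppt_of G S = (LEAST t. colored G S t = verts G)"

text \<open>
  The minima below range over nonempty finite sets when \<open>G\<close> has finitely many vertices,
  since the set of all vertices is power dominating.
\<close>

definition power_dom_number :: "('a,'b) pre_digraph \<Rightarrow> nat" where
  "power_dom_number G = (MIN S \<in> {S. power_dominating G S}. card S)"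

definition ppt :: "('a,'b) pre_digraph \<Rightarrow> nat" where
  "ppt G = (MIN S \<in> {S. power_dominating G S \<and> card S = power_dom_number G}. ppt_of G S)"

definition pd_throttling :: "('a,'b) pre_digraph \<Rightarrow> nat" where
  "pd_throttling G = (MIN S \<in> {S. power_dominating G S}. card S + ppt_of G S)"

end

theory Submission
  imports Defs "HOL-Library.Countable"
begin

text \<open>
  Lower bound: in a power dominating set of the union, all vertices outside \<open>G1\<close> can be traded for a
  single clique vertex, since color reaches \<open>G1\<close> from outside only through the clique, and one
  clique vertex colors the whole clique in the first timestep. Equality holds for \<open>G1 = G2\<close>.
  Upper bound: once the clique is added to the union of optimal sets for \<open>G1\<close> and \<open>G2\<close>, its
  closed neighborhood is colored after the first timestep, so every later force happens at a
  vertex whose neighbors all lie in one part.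
\<close>

section \<open>Timesteps and throttling\<close>

text \<open>The rule in \<open>colored\<close> wants \<open>w\<close> still uncolored. Allowing
  \<open>w\<close> to be colored already is what simulations need, where one process may be ahead of
  the other.\<close>

lemma colored_forceI:
  assumes "v \<in> colored G S (Suc t)" "w \<in> neighbors G v"
    and "neighbors G v \<subseteq> insert w (colored G S (Suc t))"
  shows "w \<in> colored G S (Suc (Suc t))"
proof (cases "w \<in> colored G S (Suc t)")
  case False
  then have "neighbors G v - colored G S (Suc t) = {w}"
    using assms by blast
  then show ?thesis
    using assms(1) by auto
qed simp

lemma colored_mono:
  assumes "s \<le> t"
  shows "colored G S s \<subseteq> colored G S t"
proof -
  have "colored G S n \<subseteq> colored G S (Suc n)" for n
    by (cases n) (auto simp: closed_neighborhood_def)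
  then show ?thesis
    using assms by (rule lift_Suc_mono_le)
qed

lemma colored_subset_verts:
  assumes "S \<subseteq> verts G" "\<And>v. neighbors G v \<subseteq> verts G"
  shows "colored G S t \<subseteq> verts G"
  using assms
  by (induction G S t rule: colored.induct) (fastforce simp: closed_neighborhood_def)+

section \<open>Minima over power dominating sets\<close>

lemma finite_power_dominating:
  assumes "finite (verts G)"
  shows "finite {S. power_dominating G S \<and> P S}"
  by (rule finite_subset[of _ "Pow (verts G)"]) (use assms in \<open>auto simp: power_dominating_def\<close>)

lemma power_dominating_verts: "power_dominating G (verts G)"
  unfolding power_dominating_def by (auto intro: exI[of _ 0])

lemma ppt_of_le: "colored G S t = verts G \<Longrightarrow> ppt_of G S \<le> t"
  unfolding ppt_of_def by (rule Least_le)

lemma colored_ppt_of: "power_dominating G S \<Longrightarrow> colored G S (ppt_of G S) = verts G"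
  unfolding ppt_of_def power_dominating_def
  using LeastI_ex[of "\<lambda>t. colored G S t = verts G"] by blast

text \<open>Any time \<open>t\<close> at which all vertices are colored will do, not only the least
  one, so applications never have to compute \<open>ppt_of\<close>.\<close>

lemma pd_throttling_le:
  assumes "finite (verts G)" "S \<subseteq> verts G" "colored G S t = verts G"
  shows "pd_throttling G \<le> card S + t"
proof -
  have pd: "power_dominating G S"
    using assms by (auto simp: power_dominating_def)
  have "pd_throttling G \<le> card S + ppt_of G S"
    unfolding pd_throttling_def
    by (rule Min_le) (use finite_power_dominating[OF assms(1), of "\<lambda>_. True"] pd in auto)
  also have "\<dots> \<le> card S + t"
    using ppt_of_le[OF assms(3)] by simp
  finally show ?thesis .
qed

lemma pd_throttling_witness:
  assumes "finite (verts G)"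
  obtains S t where "S \<subseteq> verts G" "colored G S t = verts G" "pd_throttling G = card S + t"
proof -
  have "pd_throttling G \<in> (\<lambda>S. card S + ppt_of G S) ` {S. power_dominating G S}"
    unfolding pd_throttling_def
    by (rule Min_in)
      (use finite_power_dominating[OF assms, of "\<lambda>_. True"] power_dominating_verts in auto)
  then obtain S where "power_dominating G S" "pd_throttling G = card S + ppt_of G S"
    by auto
  then show ?thesis
    using that colored_ppt_of unfolding power_dominating_def by blast
qed

lemma power_dom_number_witness:
  assumes "finite (verts G)"
  obtains S where "power_dominating G S" "card S = power_dom_number G"
proof -
  have "power_dom_number G \<in> card ` {S. power_dominating G S}"
    unfolding power_dom_number_def
    by (rule Min_in)
      (use finite_power_dominating[OF assms, of "\<lambda>_. True"] power_dominating_verts in auto)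
  then show ?thesis
    using that by auto
qed

lemma ppt_witness:
  assumes "finite (verts G)"
  obtains S where "S \<subseteq> verts G" "card S = power_dom_number G" "colored G S (ppt G) = verts G"
proof -
  obtain S0 where "power_dominating G S0" "card S0 = power_dom_number G"
    using assms by (rule power_dom_number_witness)
  then have "ppt G \<in> ppt_of G ` {S. power_dominating G S \<and> card S = power_dom_number G}"
    unfolding ppt_def
    by (intro Min_in) (use finite_power_dominating[OF assms] in auto)
  then obtain S where S: "power_dominating G S" "card S = power_dom_number G" "ppt G = ppt_of G S"
    by auto
  then have "colored G S (ppt G) = verts G"
    using colored_ppt_of[OF S(1)] by simp
  then show ?thesis
    using that S unfolding power_dominating_def by blast
qed

lemma colored_empty: "colored G {} t = {}"
  by (induction G "{} :: 'a set" t rule: colored.induct) (auto simp: closed_neighborhood_def)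

text \<open>The empty set never colors anything, so on a graph with a vertex a one-element power
  dominating set has minimum cardinality and competes in \<open>ppt\<close>.\<close>

lemma single_power_dominating_bounds:
  assumes "finite (verts G)" "v \<in> verts G" "colored G {v} t = verts G"
  shows "power_dom_number G = 1" "ppt G \<le> t"
proof -
  have pd: "power_dominating G {v}"
    using assms by (auto simp: power_dominating_def)
  have "power_dom_number G \<le> card {v}"
    unfolding power_dom_number_def
    by (intro Min_le imageI) (use finite_power_dominating[OF assms(1), of "\<lambda>_. True"] pd in auto)
  moreover have "power_dom_number G \<noteq> 0"
  proof
    assume zero: "power_dom_number G = 0"
    obtain S where S: "power_dominating G S" "card S = power_dom_number G"
      using assms(1) by (rule power_dom_number_witness)
    then have "S = {}"
      using zero assms(1) finite_subset by (fastforce simp: power_dominating_def)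
    then show False
      using S(1) assms(2) colored_empty[of G] by (auto simp: power_dominating_def)
  qed
  ultimately show number: "power_dom_number G = 1"
    by simp
  have "ppt G \<le> ppt_of G {v}"
    unfolding ppt_def
    by (rule Min_le) (use finite_power_dominating[OF assms(1)] pd number in auto)
  then show "ppt G \<le> t"
    using ppt_of_le[OF assms(3)] by simp
qed

text \<open>
  A set in which no outside vertex has exactly one neighbor is known as a fort: forcing can
  never enter it, only the domination step can.
\<close>

lemma fort_meets_power_dominating:
  assumes "colored G S t = verts G" "F \<subseteq> verts G" "F \<noteq> {}"
    and fort: "\<And>v w. v \<notin> F \<Longrightarrow> neighbors G v \<inter> F \<noteq> {w}"
  obtains s where "s \<in> S" "s \<in> F \<or> neighbors G s \<inter> F \<noteq> {}"
proof (rule ccontr)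
  assume "\<not> thesis"
  with that have avoid: "s \<notin> F \<and> neighbors G s \<inter> F = {}" if "s \<in> S" for s
    using \<open>s \<in> S\<close> by blast
  have first: "colored G S (Suc n) \<inter> F = {}" for n
  proof (induction n)
    case 0
    show ?case using avoid by (auto simp: closed_neighborhood_def)
  next
    case (Suc n)
    \<comment> \<open>All of \<open>F\<close> is still uncolored, so a force onto \<open>w\<close>
      in \<open>F\<close> would make \<open>w\<close> the only neighbor of \<open>v\<close> in
      \<open>F\<close>.\<close>
    have False if "w \<in> F" "v \<in> colored G S (Suc n)"
      "neighbors G v - colored G S (Suc n) = {w}" for v w
      using that Suc.IH fort[of v w] by blast
    then show ?case using Suc.IH by auto
  qed
  \<comment> \<open>\<open>first\<close> starts at timestep 1; monotonicity covers
    \<open>t = 0\<close>.\<close>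
  have "colored G S t \<inter> F = {}"
    using first[of t] colored_mono[of t "Suc t" G S] by auto
  then show False
    using assms(1-3) by auto
qed

section \<open>Gluing along a clique\<close>

lemma neighbors_with_proj: "neighbors (with_proj G) v = {w. (v, w) \<in> parcs G}"
  by (simp add: neighbors_def)

text \<open>Every arc is its own pair of ends, so \<open>union\<close> does not depend on whose
  \<open>tail\<close> and \<open>head\<close> it keeps. Here and for \<open>inter\<close> below,
  this makes the operation commutative.\<close>

lemma union_with_proj:
  "union (with_proj G) (with_proj H)
    = with_proj \<lparr>pverts = pverts G \<union> pverts H, parcs = parcs G \<union> parcs H\<rparr>"
  by (simp add: union_def with_proj_def)

lemma inter_with_proj:
  "inter (with_proj G) (with_proj H)
    = with_proj \<lparr>pverts = pverts G \<inter> pverts H, parcs = parcs G \<inter> parcs H\<rparr>"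
  by (simp add: inter_def with_proj_def)

locale clique_sum =
  fixes G1 G2 :: "'a pair_pre_digraph" and k :: nat
  assumes simple1: "simple_graph G1" and simple2: "simple_graph G2"
    and k_pos: "k \<ge> 1"
    and clique: "K\<^bsub>k\<^esub> (inter G1 G2)"
begin

abbreviation "C \<equiv> pverts G1 \<inter> pverts G2"
abbreviation "U \<equiv> union (with_proj G1) (with_proj G2)"

text \<open>The hypotheses are symmetric, so each fact proved for \<open>G1\<close> can be reused
  for \<open>G2\<close>.\<close>

lemma swap: "clique_sum G2 G1 k"
  using simple1 simple2 k_pos clique
  by unfold_locales (simp_all add: inter_with_proj Int_commute)

lemma union_swap: "union (with_proj G2) (with_proj G1) = U"
  by (simp add: union_with_proj Un_commute)

lemma card_C: "card C = k"
  and arcs_C: "parcs G1 \<inter> parcs G2 = {(u, v). u \<in> C \<and> v \<in> C \<and> u \<noteq> v}"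
  using clique unfolding inter_with_proj complete_digraph_pair_def by auto

lemma C_nonempty: "C \<noteq> {}"
  using card_C k_pos by auto

lemma finite1: "finite (pverts G1)" and finite2: "finite (pverts G2)"
  using simple1 simple2
  by (auto simp: simple_graph_def pair_graph_def pair_digraph_def pair_fin_digraph_def
      pair_fin_digraph_axioms_def)

lemma arcs1: "(u, v) \<in> parcs G1 \<Longrightarrow> u \<in> pverts G1 \<and> v \<in> pverts G1"
  and arcs2: "(u, v) \<in> parcs G2 \<Longrightarrow> u \<in> pverts G2 \<and> v \<in> pverts G2"
  using simple1 simple2
  by (auto simp: simple_graph_def pair_graph_def pair_digraph_def pair_fin_digraph_def
      pair_wf_digraph_def)

lemma verts_U: "verts U = pverts G1 \<union> pverts G2"
  by (simp add: union_def)

lemma neighbors_U: "neighbors U v = neighbors G1 v \<union> neighbors G2 v"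
  by (auto simp: union_with_proj neighbors_with_proj)

lemma neighbors1_subset: "neighbors G1 v \<subseteq> pverts G1"
  and neighbors2_subset: "neighbors G2 v \<subseteq> pverts G2"
  using arcs1 arcs2 by (auto simp: neighbors_with_proj)

lemma neighbors_outside1: "v \<notin> pverts G1 \<Longrightarrow> neighbors G1 v = {}"
  and neighbors_outside2: "v \<notin> pverts G2 \<Longrightarrow> neighbors G2 v = {}"
  using arcs1 arcs2 by (auto simp: neighbors_with_proj)

section \<open>Restricting the coloring process to one part: the lower bound\<close>

lemma clique_neighbors1: "c \<in> C \<Longrightarrow> C \<subseteq> insert c (neighbors G1 c)"
  using arcs_C by (auto simp: neighbors_with_proj)

text \<open>An edge of \<open>G2\<close> with both ends in \<open>G1\<close> joins two vertices of
  the complete intersection, so it is an edge of \<open>G1\<close> too. This is why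
  \<open>G1\<close> is an induced subgraph of the union
  (\<open>neighbors_U_inside1\<close>).\<close>

lemma neighbors1_clique:
  assumes "v \<in> C"
  shows "neighbors G2 v \<inter> pverts G1 \<subseteq> neighbors G1 v"
proof
  fix w assume w: "w \<in> neighbors G2 v \<inter> pverts G1"
  then have "w \<in> C" and "v \<noteq> w"
    using neighbors2_subset[of v] simple2
    by (auto simp: neighbors_with_proj simple_graph_def pair_graph_def pair_digraph_def
        pair_loopfree_digraph_def pair_loopfree_digraph_axioms_def)
  then show "w \<in> neighbors G1 v"
    using clique_neighbors1[OF assms] by blast
qed

lemma neighbors_U_inside1: "v \<in> pverts G1 \<Longrightarrow> neighbors U v \<inter> pverts G1 = neighbors G1 v"
  using neighbors1_clique[of v] neighbors1_subset[of v] neighbors_outside2[of v]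
  unfolding neighbors_U by blast

text \<open>
  Color can enter or leave the part outside \<open>G1\<close> only through the clique, and a clique vertex
  that forces a vertex outside \<open>G1\<close> has all of the clique colored already.
\<close>

lemma colored_union_inside1:
  assumes S1: "S \<inter> pverts G1 \<subseteq> S1" and enter: "S \<subseteq> pverts G1 \<or> S1 \<inter> C \<noteq> {}"
  shows "colored U S (Suc t) \<inter> pverts G1 \<subseteq> colored G1 S1 (Suc t) \<and>
    (colored U S (Suc t) \<subseteq> pverts G1 \<or> C \<subseteq> colored G1 S1 (Suc t))"
\<comment> \<open>The second conjunct strengthens the induction: once color is outside
  \<open>G1\<close>, the whole clique is colored in \<open>G1\<close>. This can fail at timestep 0,
  where \<open>S1\<close> may hold a single clique vertex; hence \<open>Suc t\<close>.\<close>
proof (induction t)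
  case 0
  have C_if: "C \<subseteq> closed_neighborhood G1 S1" if meet: "S1 \<inter> C \<noteq> {}"
  proof -
    obtain c where c: "c \<in> S1" "c \<in> C" using meet by blast
    have "insert c (neighbors G1 c) \<subseteq> closed_neighborhood G1 S1"
      using c(1) by (auto simp: closed_neighborhood_def)
    then show ?thesis using clique_neighbors1[OF c(2)] by (rule order_trans[rotated])
  qed
  have "w \<in> closed_neighborhood G1 S1" if "s \<in> S" "w \<in> neighbors U s" "w \<in> pverts G1" for s w
  proof (cases "s \<in> pverts G1")
    case True
    then have "w \<in> neighbors G1 s" using that neighbors_U_inside1 by blast
    then show ?thesis using True that S1 by (auto simp: closed_neighborhood_def)
  next
    case False
    then have "w \<in> C"
      using that neighbors_outside1[of s] neighbors2_subset[of s] unfolding neighbors_U by blast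
    moreover have "\<not> S \<subseteq> pverts G1" using False that(1) by blast
    ultimately show ?thesis using enter C_if by blast
  qed
  then have "closed_neighborhood U S \<inter> pverts G1 \<subseteq> closed_neighborhood G1 S1"
    using S1 by (auto simp: closed_neighborhood_def)
  \<comment> \<open>If \<open>S1\<close> misses the clique, then \<open>enter\<close> and
    \<open>S1\<close> keep \<open>S\<close> inside \<open>G1\<close> and off \<open>G2\<close>, so
    the domination step cannot leave \<open>G1\<close>.\<close>
  moreover have "closed_neighborhood U S \<subseteq> pverts G1" if "S1 \<inter> C = {}"
  proof -
    have S: "S \<subseteq> pverts G1" using that enter by blast
    have "neighbors U s \<subseteq> pverts G1" if "s \<in> S" for s
    proof -
      have "s \<notin> pverts G2"
        using that S S1 \<open>S1 \<inter> C = {}\<close> by blast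
      then show ?thesis
        using neighbors1_subset neighbors_outside2 by (simp add: neighbors_U)
    qed
    then show ?thesis
      using S unfolding closed_neighborhood_def by blast
  qed
  ultimately show ?case using C_if unfolding colored.simps(2) by blast
next
  case (Suc t)
  let ?A = "colored U S (Suc t)" and ?B = "colored G1 S1 (Suc t)"
  have mono: "?B \<subseteq> colored G1 S1 (Suc (Suc t))" by auto
  have IH1: "?A \<inter> pverts G1 \<subseteq> ?B" and IH2: "?A \<subseteq> pverts G1 \<or> C \<subseteq> ?B"
    using Suc.IH by simp_all
  have forced: "w \<in> neighbors U v" "neighbors U v \<subseteq> insert w ?A"
    if "neighbors U v - ?A = {w}" for v w
    using that by auto
  have inside: "w \<in> colored G1 S1 (Suc (Suc t))"
    if v: "v \<in> ?A" and w: "neighbors U v - ?A = {w}" "w \<in> pverts G1" for v w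
  proof (cases "v \<in> pverts G1")
    case True
    \<comment> \<open>The same force works in \<open>G1\<close>, whose neighborhoods are those of
      the union cut down to \<open>G1\<close>; the run in \<open>G1\<close> may already have colored
      \<open>w\<close>.\<close>
    have "neighbors G1 v \<subseteq> insert w ?A \<inter> pverts G1"
      using forced(2)[OF w(1)] unfolding neighbors_U_inside1[OF True, symmetric] by blast
    then have "neighbors G1 v \<subseteq> insert w ?B"
      using IH1 by blast
    moreover have "w \<in> neighbors G1 v"
      using forced(1)[OF w(1)] w(2) unfolding neighbors_U_inside1[OF True, symmetric] by blast
    moreover have "v \<in> ?B"
      using True v IH1 by blast
    ultimately show ?thesis
      by (intro colored_forceI)
  next
    case False
    \<comment> \<open>A force from outside \<open>G1\<close> lands in the clique, which the second
      half of the invariant declares colored.\<close>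
    then have "w \<in> C"
      using forced(1)[OF w(1)] w(2) neighbors_outside1[of v] neighbors2_subset[of v]
      unfolding neighbors_U by blast
    moreover have "C \<subseteq> ?B" using False v IH2 by blast
    ultimately show ?thesis using mono by blast
  qed
  have outside: "C \<subseteq> ?B"
    if A: "?A \<subseteq> pverts G1" and v: "v \<in> ?A" and w: "neighbors U v - ?A = {w}" "w \<notin> pverts G1"
    for v w
  proof -
    have "w \<in> neighbors G2 v"
      using forced(1)[OF w(1)] w(2) neighbors1_subset[of v] unfolding neighbors_U by blast
    then have "v \<in> C" using v A neighbors_outside2[of v] by auto
    then have "C \<subseteq> insert v (neighbors U v)"
      using clique_neighbors1[of v] unfolding neighbors_U by blast
    then have "C \<subseteq> ?A" using v w(2) forced(2)[OF w(1)] by blast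
    then show ?thesis using IH1 by blast
  qed
  show ?case
  proof
    show "colored U S (Suc (Suc t)) \<inter> pverts G1 \<subseteq> colored G1 S1 (Suc (Suc t))"
    proof
      fix w assume "w \<in> colored U S (Suc (Suc t)) \<inter> pverts G1"
      then consider "w \<in> ?A" "w \<in> pverts G1"
        | v where "v \<in> ?A" "neighbors U v - ?A = {w}" "w \<in> pverts G1"
        unfolding colored.simps(3) by blast
      then show "w \<in> colored G1 S1 (Suc (Suc t))"
      proof cases
        case 1
        then show ?thesis using IH1 mono by blast
      next
        case 2
        then show ?thesis by (rule inside)
      qed
    qed
    show "colored U S (Suc (Suc t)) \<subseteq> pverts G1 \<or> C \<subseteq> colored G1 S1 (Suc (Suc t))"
    proof (cases "C \<subseteq> ?B")
      case True
      then show ?thesis using mono by blast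
    next
      case False
      then have "?A \<subseteq> pverts G1" using IH2 by blast
      then have "colored U S (Suc (Suc t)) \<subseteq> pverts G1"
        unfolding colored.simps(3) using outside False by blast
      then show ?thesis ..
    qed
  qed
qed

lemma pd_throttling_part1: "pd_throttling G1 \<le> pd_throttling U"
proof -
  have fin: "finite (verts U)" using finite1 finite2 by (simp add: verts_U)
  then obtain S t where S: "S \<subseteq> verts U" "colored U S t = verts U"
    and th: "pd_throttling U = card S + t"
    by (rule pd_throttling_witness)
  have fin_S: "finite S" using S(1) fin by (rule finite_subset)
  have sub: "colored G1 T n \<subseteq> pverts G1" if "T \<subseteq> pverts G1" for T n
    using colored_subset_verts[of T "with_proj G1"] that neighbors1_subset by simp
  have bound: "pd_throttling G1 \<le> card S1 + t"
    if "S \<inter> pverts G1 \<subseteq> S1" "S \<subseteq> pverts G1 \<or> S1 \<inter> C \<noteq> {}" "S1 \<subseteq> pverts G1" "t = Suc n" for S1 n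
  proof -
    have "pverts G1 \<subseteq> colored G1 S1 t"
      using colored_union_inside1[OF that(1,2), of n] S(2) that(4) by (auto simp: verts_U)
    then have "colored G1 S1 t = pverts G1" using sub[OF that(3)] by blast
    then show ?thesis using pd_throttling_le[of "with_proj G1" S1 t] finite1 that(3) by simp
  qed
  show ?thesis
  proof (cases t)
    \<comment> \<open>The simulation starts at timestep 1. At time 0 the set \<open>S\<close> is
      everything, and all vertices of \<open>G1\<close> are no more expensive.\<close>
    case 0
    then have "S = verts U" using S(2) by simp
    then have "card (pverts G1) \<le> card S" using fin by (intro card_mono) (auto simp: verts_U)
    then show ?thesis
      using pd_throttling_le[of "with_proj G1" "pverts G1" 0] finite1 th by simp
  next
    case (Suc n)
    show ?thesis
    proof (cases "S \<subseteq> pverts G1")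
      case True
      then show ?thesis using bound[of S] Suc th by simp
    next
      case outside: False
      obtain c where c: "c \<in> C" using C_nonempty by blast
      \<comment> \<open>At least one vertex of \<open>S\<close> is dropped, which pays for
        \<open>c\<close>.\<close>
      have "card (S \<inter> pverts G1) < card S"
        using outside fin_S by (intro psubset_card_mono) auto
      then have "card (insert c (S \<inter> pverts G1)) \<le> card S"
        using fin_S by (simp add: card_insert_if)
      moreover have "pd_throttling G1 \<le> card (insert c (S \<inter> pverts G1)) + t"
        using c Suc by (intro bound) auto
      ultimately show ?thesis using th by simp
    qed
  qed
qed

section \<open>The upper bound\<close>

lemma colored_subset_union1:
  assumes "S1 \<subseteq> S" "C \<subseteq> S"
  shows "colored G1 S1 t \<subseteq> colored U S t"
proof -
  have later: "colored G1 S1 (Suc n) \<subseteq> colored U S (Suc n)" for n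
  proof (induction n)
    case 0
    show ?case using assms by (auto simp: closed_neighborhood_def neighbors_U)
  next
    case (Suc n)
    have "w \<in> colored U S (Suc (Suc n))"
      if v: "v \<in> colored G1 S1 (Suc n)" and w: "neighbors G1 v - colored G1 S1 (Suc n) = {w}"
      for v w
    proof (cases "v \<in> C")
      case True
      \<comment> \<open>Uncolored neighbors of \<open>v\<close> in \<open>G2\<close> might block
        this force in the union, but \<open>v\<close> is in \<open>S\<close>, so \<open>w\<close>
        was colored by domination.\<close>
      then have "w \<in> colored U S (Suc 0)"
        using w assms by (auto simp: closed_neighborhood_def neighbors_U)
      then show ?thesis using colored_mono[of "Suc 0" "Suc (Suc n)" U S] by auto
    next
      case False
      have "v \<in> pverts G1" using w neighbors_outside1[of v] by auto
      then have "neighbors U v = neighbors G1 v"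
        using False neighbors_outside2[of v] by (simp add: neighbors_U)
      then show ?thesis using v w Suc.IH by (intro colored_forceI[of v]) auto
    qed
    then show ?case using Suc.IH by auto
  qed
  show ?thesis
  proof (cases t)
    case 0
    then show ?thesis using assms by simp
  next
    case (Suc n)
    then show ?thesis using later by simp
  qed
qed

lemma pd_throttling_union_le:
  "pd_throttling U \<le> power_dom_number G1 + power_dom_number G2 + k + max (ppt G1) (ppt G2)"
proof -
  interpret sw: clique_sum G2 G1 k by (rule swap)
  \<comment> \<open>The slower part sets the time; the faster one stays colored by
    monotonicity.\<close>
  let ?T = "max (ppt G1) (ppt G2)"
  obtain S1 where S1: "S1 \<subseteq> pverts G1" "card S1 = power_dom_number G1"
    "colored G1 S1 (ppt G1) = pverts G1"
    using ppt_witness[of "with_proj G1"] finite1 by auto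
  obtain S2 where S2: "S2 \<subseteq> pverts G2" "card S2 = power_dom_number G2"
    "colored G2 S2 (ppt G2) = pverts G2"
    using ppt_witness[of "with_proj G2"] finite2 by auto
  let ?S = "S1 \<union> S2 \<union> C"
  have fin: "finite (verts U)" using finite1 finite2 by (simp add: verts_U)
  have S: "?S \<subseteq> verts U" using S1 S2 by (auto simp: verts_U)
  have "pverts G1 \<subseteq> colored U ?S ?T"
    using colored_subset_union1[of S1 ?S "ppt G1"] colored_mono[of "ppt G1" ?T U ?S] S1(3) by auto
  moreover have "pverts G2 \<subseteq> colored U ?S ?T"
    using sw.colored_subset_union1[of S2 ?S "ppt G2"] colored_mono[of "ppt G2" ?T U ?S] S2(3)
    by (auto simp: union_swap)
  moreover have "colored U ?S ?T \<subseteq> verts U"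
  proof (rule colored_subset_verts[OF S])
    show "neighbors U v \<subseteq> verts U" for v
      using neighbors1_subset[of v] neighbors2_subset[of v] by (auto simp: neighbors_U verts_U)
  qed
  ultimately have "colored U ?S ?T = verts U" by (auto simp: verts_U)
  then have "pd_throttling U \<le> card ?S + ?T"
    using fin S by (intro pd_throttling_le)
  also have "card ?S \<le> card S1 + card S2 + card C"
    using card_Un_le[of "S1 \<union> S2" C] card_Un_le[of S1 S2] by linarith
  finally show ?thesis using S1(2) S2(2) card_C by simp
qed

lemma pd_throttling_bounds:
  "max (pd_throttling G1) (pd_throttling G2) \<le> pd_throttling U \<and>
   pd_throttling U \<le> power_dom_number G1 + power_dom_number G2 + k + max (ppt G1) (ppt G2)"
  using pd_throttling_part1 clique_sum.pd_throttling_part1[OF swap] pd_throttling_union_le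
  by (simp add: union_swap)

end

section \<open>Tightness\<close>

text \<open>Taken as both \<open>G1\<close> and \<open>G2\<close>, this graph is its own union and
  intersection, which attains the lower bound for every \<open>k\<close>.\<close>

lemma complete_graph_exists:
  assumes "k \<ge> 1"
  shows "\<exists>G :: nat pair_pre_digraph. simple_graph G \<and> K\<^bsub>k\<^esub> (with_proj G)"
proof -
  let ?G = "\<lparr>pverts = {..<k}, parcs = {(u, v). u < k \<and> v < k \<and> u \<noteq> v}\<rparr>"
  have K: "K\<^bsub>k\<^esub> (with_proj ?G)"
    by (auto simp: complete_digraph_pair_def)
  then have "simple_graph ?G"
    using assms
    by (auto simp: simple_graph_def complete_digraph_def lessThan_empty_iff intro: pair_graphI_graph)
  then show ?thesis using K by blast
qed

text \<open>
  The core is the common clique. On either side, every core vertex carries a pendant vertex, and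
  a hub adjacent to the whole core has two legs of length two. Within one side the hub alone
  colors everything in two steps, but in the union each core vertex has two pendants and thus
  needs a vertex of its own in the power dominating set. The legs make domination in a single
  step cost four vertices instead of two.
\<close>

datatype vertex = Core nat | Pendant bool nat | Hub bool | Near bool bool | Far bool bool

instance vertex :: countable
  by countable_datatype

text \<open>Only \<open>Core\<close> carries no side flag, so the two sides share exactly the core.
  The second flag of \<open>Near\<close> and \<open>Far\<close> tells the two legs of a hub
  apart.\<close>

definition side_verts :: "nat \<Rightarrow> bool \<Rightarrow> vertex set" where
  "side_verts k p = Core ` {..<k} \<union> Pendant p ` {..<k} \<union> {Hub p} \<union> range (Near p) \<union> range (Far p)"

definition side_arcs :: "nat \<Rightarrow> bool \<Rightarrow> vertex rel" where
  "side_arcs k p = {(Core i, Core j) | i j. i < k \<and> j < k \<and> i \<noteq> j} \<union>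
     (\<lambda>i. (Core i, Pendant p i)) ` {..<k} \<union> (\<lambda>i. (Hub p, Core i)) ` {..<k} \<union>
     range (\<lambda>b. (Hub p, Near p b)) \<union> range (\<lambda>b. (Near p b, Far p b))"

definition side_adj :: "nat \<Rightarrow> bool \<Rightarrow> vertex rel" where
  "side_adj k p = side_arcs k p \<union> (side_arcs k p)\<inverse>"

text \<open>The examples have to live on \<open>nat\<close>, so the named vertices are carried over
  by the injection \<open>to_nat\<close>.\<close>

definition side :: "nat \<Rightarrow> bool \<Rightarrow> nat pair_pre_digraph" where
  "side k p = \<lparr>pverts = to_nat ` side_verts k p,
     parcs = map_prod to_nat to_nat ` side_adj k p\<rparr>"

lemma side_adj_iff:
  "(x, y) \<in> side_adj k p \<longleftrightarrow>
    (case x of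
      Core i \<Rightarrow> i < k \<and> ((\<exists>j<k. j \<noteq> i \<and> y = Core j) \<or> y = Pendant p i \<or> y = Hub p)
    | Pendant q i \<Rightarrow> q = p \<and> i < k \<and> y = Core i
    | Hub q \<Rightarrow> q = p \<and> ((\<exists>i<k. y = Core i) \<or> (\<exists>b. y = Near p b))
    | Near q b \<Rightarrow> q = p \<and> (y = Hub p \<or> y = Far p b)
    | Far q b \<Rightarrow> q = p \<and> y = Near p b)"
  by (cases x; cases y) (auto simp: side_adj_def side_arcs_def)

text \<open>Adjacency read from the target, for arguments that know which vertex gets colored and
  ask from where.\<close>

lemma side_adj_into:
  "(x, Pendant q i) \<in> side_adj k p \<longleftrightarrow> q = p \<and> i < k \<and> x = Core i"
  "(x, Near q b) \<in> side_adj k p \<longleftrightarrow> q = p \<and> (x = Hub p \<or> x = Far p b)"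
  "(x, Far q b) \<in> side_adj k p \<longleftrightarrow> q = p \<and> x = Near p b"
  by (cases x; auto simp: side_adj_iff)+

lemma finite_side_verts: "finite (side_verts k p)"
  by (simp add: side_verts_def)

lemma side_adj_verts: "(x, y) \<in> side_adj k p \<Longrightarrow> x \<in> side_verts k p \<and> y \<in> side_verts k p"
  by (auto simp: side_adj_def side_arcs_def side_verts_def)

lemma side_adj_sym: "(x, y) \<in> side_adj k p \<Longrightarrow> (y, x) \<in> side_adj k p"
  by (auto simp: side_adj_def)

lemma side_adj_irrefl: "(x, x) \<notin> side_adj k p"
  by (auto simp: side_adj_def side_arcs_def)

lemma simple_graph_side: "simple_graph (side k p)"
proof -
  have "side_adj k p \<subseteq> side_verts k p \<times> side_verts k p"
    using side_adj_verts by auto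
  then have fin: "finite (side_adj k p)"
    using finite_side_verts finite_subset by blast
  have "pair_graph (side k p)"
  proof
    show "symmetric (side k p)"
      using side_adj_sym by (force simp: side_def symmetric_def intro: symI)
  qed (use side_adj_verts side_adj_irrefl finite_side_verts fin in \<open>auto simp: side_def\<close>)
  moreover have "pverts (side k p) \<noteq> {}"
    by (simp add: side_def side_verts_def)
  ultimately show ?thesis by (simp add: simple_graph_def)
qed

lemma side_clique: "K\<^bsub>k\<^esub> (inter (side k True) (side k False))"
proof -
  have verts: "side_verts k True \<inter> side_verts k False = Core ` {..<k}"
    by (auto simp: side_verts_def)
  have arcs: "side_adj k True \<inter> side_adj k False
      = {(Core i, Core j) | i j. i < k \<and> j < k \<and> i \<noteq> j}"
    by (auto simp: side_adj_def side_arcs_def)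
  have inj: "inj (map_prod (to_nat :: vertex \<Rightarrow> nat) (to_nat :: vertex \<Rightarrow> nat))"
    by (intro prod.inj_map inj_to_nat)
  have "pverts (side k True) \<inter> pverts (side k False) = to_nat ` Core ` {..<k}"
    by (simp add: side_def verts flip: image_Int[OF inj_to_nat])
  moreover have "parcs (side k True) \<inter> parcs (side k False)
      = map_prod to_nat to_nat ` {(Core i, Core j) | i j. i < k \<and> j < k \<and> i \<noteq> j}"
    by (simp add: side_def arcs flip: image_Int[OF inj])
  moreover have "card (to_nat ` Core ` {..<k}) = k"
    by (simp add: card_image inj_on_def)
  ultimately show ?thesis
    by (force simp: inter_with_proj complete_digraph_pair_def)
qed

lemma neighbors_side: "neighbors (side k p) (to_nat x) = to_nat ` {y. (x, y) \<in> side_adj k p}"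
  by (auto simp: neighbors_with_proj side_def)

text \<open>Timestep 1 colors the core and the near vertices. Then each core vertex lacks only its
  pendant and each near vertex only its far vertex, so timestep 2 forces all the rest at
  once.\<close>

lemma
  shows power_dom_number_side: "power_dom_number (side k p) = 1"
    and ppt_side: "ppt (side k p) \<le> 2"
proof -
  let ?G = "with_proj (side k p)"
  let ?S = "{to_nat (Hub p)}"
  have one: "colored ?G ?S (Suc 0)
      = to_nat ` ({Hub p} \<union> Core ` {..<k} \<union> range (Near p))"
    by (auto simp: closed_neighborhood_def neighbors_side side_adj_iff)
  have pendant: "to_nat (Pendant p i) \<in> colored ?G ?S (Suc (Suc 0))" if "i < k" for i
  proof (rule colored_forceI)
    show "to_nat (Core i) \<in> colored ?G ?S (Suc 0)"
      unfolding one using that by auto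
  qed (unfold one neighbors_side, use that in \<open>auto simp: side_adj_iff\<close>)
  have far: "to_nat (Far p b) \<in> colored ?G ?S (Suc (Suc 0))" for b
  proof (rule colored_forceI)
    show "to_nat (Near p b) \<in> colored ?G ?S (Suc 0)"
      unfolding one by auto
  qed (unfold one neighbors_side, auto simp: side_adj_iff)
  have verts: "verts ?G = to_nat ` side_verts k p" by (simp add: side_def)
  have "neighbors ?G v \<subseteq> verts ?G" for v
    using side_adj_verts by (auto simp: neighbors_with_proj side_def)
  then have "colored ?G ?S (Suc (Suc 0)) \<subseteq> verts ?G"
    by (intro colored_subset_verts) (auto simp: side_def side_verts_def)
  moreover have "verts ?G \<subseteq> colored ?G ?S (Suc (Suc 0))"
  proof -
    have "to_nat ` ({Hub p} \<union> Core ` {..<k} \<union> range (Near p)) \<subseteq> colored ?G ?S (Suc (Suc 0))"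
      unfolding one[symmetric] by (rule colored_mono) simp
    then show ?thesis
      using pendant far unfolding verts side_verts_def by blast
  qed
  ultimately have all: "colored ?G ?S 2 = verts ?G"
    unfolding numeral_2_eq_2 by (rule subset_antisym)
  have fin: "finite (verts ?G)" unfolding verts by (simp add: finite_side_verts)
  have hub: "to_nat (Hub p) \<in> verts ?G" unfolding verts by (simp add: side_verts_def)
  show "power_dom_number (side k p) = 1" "ppt (side k p) \<le> 2"
    by (rule single_power_dominating_bounds[OF fin hub all])+
qed

text \<open>
  A power dominating set of the union meets the fibers of \<open>hub_class\<close> over the core and the hubs;
  if one step suffices, it even meets those of \<open>leg_class\<close> over the core and the near vertices.
\<close>

primrec hub_class :: "vertex \<Rightarrow> vertex" where
  "hub_class (Core i) = Core i"
| "hub_class (Pendant p i) = Core i"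
| "hub_class (Hub p) = Hub p"
| "hub_class (Near p b) = Hub p"
| "hub_class (Far p b) = Hub p"

primrec leg_class :: "vertex \<Rightarrow> vertex" where
  "leg_class (Core i) = Core i"
| "leg_class (Pendant p i) = Core i"
| "leg_class (Hub p) = Hub p"
| "leg_class (Near p b) = Near p b"
| "leg_class (Far p b) = Near p b"

text \<open>With \<open>t\<close> at least 2, the set needs \<open>k + 2\<close> vertices, one per
  core vertex and one per hub; with \<open>t\<close> at most 1 it needs \<open>k + 4\<close>, one
  per core vertex and one per leg. Either way the sum is at least \<open>k + 4\<close>.\<close>

lemma pd_throttling_sides: "k + 4 \<le> pd_throttling (union (side k True) (side k False))"
proof -
  let ?U = "union (with_proj (side k True)) (with_proj (side k False))"
  have verts: "verts ?U = to_nat ` (side_verts k True \<union> side_verts k False)"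
    by (auto simp: union_def side_def)
  have nbrs: "neighbors ?U (to_nat x) = to_nat ` {y. \<exists>p. (x, y) \<in> side_adj k p}" for x
  proof -
    have "neighbors ?U (to_nat x)
        = neighbors (side k True) (to_nat x) \<union> neighbors (side k False) (to_nat x)"
      by (auto simp: union_with_proj neighbors_with_proj)
    also have "\<dots> = to_nat ` ({y. (x, y) \<in> side_adj k True} \<union> {y. (x, y) \<in> side_adj k False})"
      unfolding neighbors_side image_Un ..
    also have "{y. (x, y) \<in> side_adj k True} \<union> {y. (x, y) \<in> side_adj k False}
        = {y. \<exists>p. (x, y) \<in> side_adj k p}"
      unfolding ex_bool_eq by blast
    finally show ?thesis .
  qed
  have nbrs_iff: "to_nat y \<in> neighbors ?U (to_nat x) \<longleftrightarrow> (\<exists>p. (x, y) \<in> side_adj k p)" for x y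
    unfolding nbrs by auto
  have nbrs_outside: "neighbors ?U v = {}" if "v \<notin> range (to_nat :: vertex \<Rightarrow> nat)" for v
    using that by (force simp: union_with_proj neighbors_with_proj side_def)
  have in_verts: "to_nat x \<in> verts ?U" if "x \<in> side_verts k p" for x p
    using that unfolding verts by (cases p) auto
  have "finite (verts ?U)" unfolding verts by (simp add: finite_side_verts)
  then obtain S t where S: "S \<subseteq> verts ?U" "colored ?U S t = verts ?U"
    and th: "pd_throttling ?U = card S + t"
    by (rule pd_throttling_witness)
  have fin_S: "finite S" using S(1) \<open>finite (verts ?U)\<close> by (rule finite_subset)
  have S_range: "\<exists>x :: vertex. s = to_nat x" if "s \<in> S" for s
    using that S(1) unfolding verts by blast
  \<comment> \<open>Fibers of \<open>f\<close> over distinct points are disjoint, so meeting each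
    fiber over \<open>L\<close> takes \<open>card L\<close> vertices.\<close>
  have count: "card L \<le> card S"
    if hit: "\<And>l. l \<in> L \<Longrightarrow> \<exists>x. to_nat x \<in> S \<and> f x = l" for L and f :: "vertex \<Rightarrow> vertex"
  proof (rule surj_card_le[OF fin_S, of L "\<lambda>s. f (from_nat s)"])
    show "L \<subseteq> (\<lambda>s. f (from_nat s)) ` S"
    proof
      fix l assume "l \<in> L"
      then obtain x where "to_nat x \<in> S" "f x = l" using hit by blast
      then show "l \<in> (\<lambda>s. f (from_nat s)) ` S" by (intro image_eqI[of _ _ "to_nat x"]) simp_all
    qed
  qed
  \<comment> \<open>The fort lemma in terms of named vertices. The second neighbor \<open>z\<close>
    may be reached by an edge of the other side, hence the separate \<open>q\<close>.\<close>
  have fort: "\<exists>x. to_nat x \<in> S \<and> (x \<in> F \<or> (\<exists>y\<in>F. \<exists>p. (x, y) \<in> side_adj k p))"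
    if F: "to_nat ` F \<subseteq> verts ?U" "F \<noteq> {}"
      and two: "\<And>x y p. x \<notin> F \<Longrightarrow> y \<in> F \<Longrightarrow> (x, y) \<in> side_adj k p
        \<Longrightarrow> \<exists>z\<in>F. z \<noteq> y \<and> (\<exists>q. (x, z) \<in> side_adj k q)" for F
  proof -
    have "neighbors ?U v \<inter> to_nat ` F \<noteq> {w}" if "v \<notin> to_nat ` F" for v w
    proof
      assume single: "neighbors ?U v \<inter> to_nat ` F = {w}"
      then obtain x :: vertex where x: "v = to_nat x" using nbrs_outside by blast
      obtain y where y: "w = to_nat y" "y \<in> F" "w \<in> neighbors ?U v"
        using single by blast
      then obtain p where "(x, y) \<in> side_adj k p"
        unfolding x y(1) nbrs_iff by blast
      have "x \<notin> F" using that x by blast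
      then obtain z q where z: "z \<in> F" "z \<noteq> y" "(x, z) \<in> side_adj k q"
        using two[OF _ y(2)] \<open>(x, y) \<in> side_adj k p\<close> by blast
      then have "to_nat z \<in> neighbors ?U v \<inter> to_nat ` F"
        unfolding x by (blast intro: nbrs_iff[THEN iffD2])
      then show False using z(2) unfolding single y(1) by simp
    qed
    then obtain s where s: "s \<in> S" "s \<in> to_nat ` F \<or> neighbors ?U s \<inter> to_nat ` F \<noteq> {}"
      using fort_meets_power_dominating[OF S(2) F(1)] F(2) by blast
    obtain x :: vertex where x: "s = to_nat x" using S_range s(1) by blast
    have "x \<in> F \<or> (\<exists>y\<in>F. to_nat y \<in> neighbors ?U (to_nat x))"
      using s(2) unfolding x by auto
    then show ?thesis using s(1) unfolding x nbrs_iff by blast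
  qed
  show ?thesis
  proof (cases "t \<le> 1")
    case True
    let ?L = "Core ` {..<k} \<union> case_prod Near ` UNIV"
    have "verts ?U \<subseteq> closed_neighborhood ?U S"
      using colored_mono[OF True, of ?U S] S(2) by simp
    then have dom: "\<exists>x. to_nat x \<in> S \<and> (x = y \<or> (\<exists>q. (x, y) \<in> side_adj k q))"
      if "y \<in> side_verts k p" for y p
    proof -
      have "to_nat y \<in> closed_neighborhood ?U S"
        using in_verts[OF that] \<open>verts ?U \<subseteq> _\<close> by blast
      then obtain s where s: "s \<in> S" "to_nat y = s \<or> to_nat y \<in> neighbors ?U s"
        unfolding closed_neighborhood_def by blast
      obtain x :: vertex where x: "s = to_nat x" using S_range s(1) by blast
      have "x = y \<or> to_nat y \<in> neighbors ?U (to_nat x)"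
        using s(2) unfolding x by auto
      then show ?thesis using s(1) unfolding x nbrs_iff by blast
    qed
    have "\<exists>x. to_nat x \<in> S \<and> leg_class x = l" if "l \<in> ?L" for l
      using that
    proof
      assume "l \<in> Core ` {..<k}"
      then obtain i where i: "i < k" "l = Core i" by auto
      then have "Pendant True i \<in> side_verts k True" by (simp add: side_verts_def)
      from dom[OF this] show ?thesis
        using i by (auto simp: side_adj_into)
    next
      assume "l \<in> case_prod Near ` UNIV"
      then obtain p b where l: "l = Near p b" by auto
      have "Far p b \<in> side_verts k p" by (simp add: side_verts_def)
      \<comment> \<open>A far vertex is dominated only from its own leg, and a pendant, above, only
        from itself or its core vertex.\<close>
      from dom[OF this] show ?thesis
        using l by (auto simp: side_adj_into)
    qed
    then have "card ?L \<le> card S" by (rule count)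
    moreover have "card ?L = card (Core ` {..<k}) + card (case_prod Near ` UNIV)"
      by (intro card_Un_disjoint) auto
    moreover have "card (case_prod Near ` UNIV) = card (UNIV :: (bool \<times> bool) set)"
      by (intro card_image) (auto simp: inj_on_def)
    moreover have "card (UNIV :: (bool \<times> bool) set) = 4"
      by (simp add: card_cartesian_product flip: UNIV_Times_UNIV)
    ultimately show ?thesis using th by (simp add: card_image inj_on_def)
  next
    case False
    let ?L = "Core ` {..<k} \<union> range Hub"
    have "\<exists>x. to_nat x \<in> S \<and> hub_class x = l" if "l \<in> ?L" for l
      using that
    proof
      assume "l \<in> Core ` {..<k}"
      then obtain i where i: "i < k" "l = Core i" by auto
      \<comment> \<open>The pendants of \<open>Core i\<close> from both sides form a fort: their
        only outside neighbor \<open>Core i\<close> sees both.\<close>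
      let ?F = "range (\<lambda>p. Pendant p i)"
      have "\<exists>x. to_nat x \<in> S \<and> (x \<in> ?F \<or> (\<exists>y\<in>?F. \<exists>p. (x, y) \<in> side_adj k p))"
      proof (rule fort)
        show "to_nat ` ?F \<subseteq> verts ?U"
        proof safe
          fix p
          have "Pendant p i \<in> side_verts k p" using i by (simp add: side_verts_def)
          then show "to_nat (Pendant p i) \<in> verts ?U" by (rule in_verts)
        qed
        show "\<exists>z\<in>?F. z \<noteq> y \<and> (\<exists>q. (x, z) \<in> side_adj k q)"
          if "y \<in> ?F" "(x, y) \<in> side_adj k p" for x y p
        proof -
          have "y = Pendant p i \<and> x = Core i"
            using that by (auto simp: side_adj_into)
          then show ?thesis
            using i by (intro bexI[of _ "Pendant (\<not> p) i"]) (auto simp: side_adj_iff)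
        qed
      qed auto
      then show ?thesis using i by (auto simp: side_adj_into)
    next
      assume "l \<in> range Hub"
      then obtain p where l: "l = Hub p" by auto
      \<comment> \<open>The two legs of a hub form a fort: the only vertex outside that touches them
        is the hub, and it sees both near vertices.\<close>
      let ?F = "range (Near p) \<union> range (Far p)"
      have "\<exists>x. to_nat x \<in> S \<and> (x \<in> ?F \<or> (\<exists>y\<in>?F. \<exists>p. (x, y) \<in> side_adj k p))"
      proof (rule fort)
        show "to_nat ` ?F \<subseteq> verts ?U"
        proof (rule image_subsetI)
          fix x assume "x \<in> ?F"
          then have "x \<in> side_verts k p" unfolding side_verts_def by blast
          then show "to_nat x \<in> verts ?U" by (rule in_verts)
        qed
        show "\<exists>z\<in>?F. z \<noteq> y \<and> (\<exists>q. (x, z) \<in> side_adj k q)"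
          if xy: "x \<notin> ?F" "y \<in> ?F" "(x, y) \<in> side_adj k r" for x y r
        proof -
          obtain b where "y = Near p b \<and> x = Hub p"
            using xy by (auto simp: side_adj_into)
          then show ?thesis
            by (intro bexI[of _ "Near p (\<not> b)"]) (auto simp: side_adj_iff)
        qed
      qed auto
      then obtain x where x: "to_nat x \<in> S" "x \<in> ?F \<or> (\<exists>y\<in>?F. \<exists>p. (x, y) \<in> side_adj k p)"
        by blast
      from x(2) have "hub_class x = Hub p" by (auto simp: side_adj_into)
      then show ?thesis using x(1) l by blast
    qed
    then have "card ?L \<le> card S" by (rule count)
    moreover have "card ?L = card (Core ` {..<k}) + card (range Hub)"
      by (intro card_Un_disjoint) auto
    moreover have "card (range Hub) = 2"
      by (simp add: card_image inj_on_def)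
    ultimately show ?thesis using th False by (simp add: card_image inj_on_def)
  qed
qed

theorem theorem9:
  fixes k :: nat
  assumes "k \<ge> 1"
  shows
    "(\<forall>G1 G2 :: 'a pair_pre_digraph.
        simple_graph G1 \<and> simple_graph G2 \<and> K\<^bsub>k\<^esub> (inter G1 G2) \<longrightarrow>
          max (pd_throttling G1) (pd_throttling G2) \<le> pd_throttling (union G1 G2) \<and>
          pd_throttling (union G1 G2)
            \<le> power_dom_number G1 + power_dom_number G2 + k + max (ppt G1) (ppt G2)) \<and>
     (\<exists>G1 G2 :: nat pair_pre_digraph.
        simple_graph G1 \<and> simple_graph G2 \<and> K\<^bsub>k\<^esub> (inter G1 G2) \<and>
          max (pd_throttling G1) (pd_throttling G2) = pd_throttling (union G1 G2)) \<and>
     (\<exists>G1 G2 :: nat pair_pre_digraph.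
        simple_graph G1 \<and> simple_graph G2 \<and> K\<^bsub>k\<^esub> (inter G1 G2) \<and>
          pd_throttling (union G1 G2)
            = power_dom_number G1 + power_dom_number G2 + k + max (ppt G1) (ppt G2))"
proof (intro conjI)
  show "\<forall>G1 G2 :: 'a pair_pre_digraph.
        simple_graph G1 \<and> simple_graph G2 \<and> K\<^bsub>k\<^esub> (inter G1 G2) \<longrightarrow>
          max (pd_throttling G1) (pd_throttling G2) \<le> pd_throttling (union G1 G2) \<and>
          pd_throttling (union G1 G2)
            \<le> power_dom_number G1 + power_dom_number G2 + k + max (ppt G1) (ppt G2)"
  proof (intro allI impI)
    fix G1 G2 :: "'a pair_pre_digraph"
    assume "simple_graph G1 \<and> simple_graph G2 \<and> K\<^bsub>k\<^esub> (inter G1 G2)"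
    then interpret clique_sum G1 G2 k
      using assms by unfold_locales simp_all
    show "max (pd_throttling G1) (pd_throttling G2) \<le> pd_throttling (union G1 G2) \<and>
        pd_throttling (union G1 G2)
          \<le> power_dom_number G1 + power_dom_number G2 + k + max (ppt G1) (ppt G2)"
      by (rule pd_throttling_bounds)
  qed
  obtain G :: "nat pair_pre_digraph" where G: "simple_graph G" "K\<^bsub>k\<^esub> (with_proj G)"
    using complete_graph_exists[OF assms] by blast
  then show "\<exists>G1 G2 :: nat pair_pre_digraph.
        simple_graph G1 \<and> simple_graph G2 \<and> K\<^bsub>k\<^esub> (inter G1 G2) \<and>
          max (pd_throttling G1) (pd_throttling G2) = pd_throttling (union G1 G2)"
    by (intro exI[of _ G]) (simp add: inter_def union_def with_proj_def)
  interpret clique_sum "side k True" "side k False" k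
    using assms by unfold_locales (simp_all add: simple_graph_side side_clique)
  \<comment> \<open>The right-hand side is at most \<open>1 + 1 + k + 2\<close>, which meets the
    lower bound \<open>k + 4\<close> on the throttling number. The squeeze gives equality with
    \<open>ppt\<close> bounded only from above.\<close>
  have "power_dom_number (side k True) + power_dom_number (side k False) + k
      + max (ppt (side k True)) (ppt (side k False)) \<le> k + 4"
    using ppt_side[of k True] ppt_side[of k False] by (simp add: power_dom_number_side)
  then have "pd_throttling U = power_dom_number (side k True) + power_dom_number (side k False) + k
      + max (ppt (side k True)) (ppt (side k False))"
    using pd_throttling_union_le pd_throttling_sides[of k] by linarith
  then show "\<exists>G1 G2 :: nat pair_pre_digraph.
        simple_graph G1 \<and> simple_graph G2 \<and> K\<^bsub>k\<^esub> (inter G1 G2) \<and>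
          pd_throttling (union G1 G2)
            = power_dom_number G1 + power_dom_number G2 + k + max (ppt G1) (ppt G2)"
    using simple1 simple2 clique by (intro exI conjI)
qed

end
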